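(* Let $1\le S'\le S$ be integers. Consider two systems of parallel queues under the Join the Shortest Workload policy (i.e. SCS($0$)), having respectively $S$ and $S'$ servers and fed by the same input $\{(\sigma_n,\tau_n);\,n\in\mathbb N\}$, with workload profile sequences $\{W_n^{0,S}\}$ and $\{W_n^{0,S'}\}$, i.e. almost surely for all $n\ge0$, $W_{n+1}^{0,S}=\Phi^{0,S}(W_n^{0,S},\sigma_n,\tau_n)$ and $W_{n+1}^{0,S'}=\Phi^{0,S'}(W_n^{0,S'},\sigma_n,\tau_n)$. Assume that the initial profiles satisfy $W_0^{0,S}\prec W_0^{0,S'}$ (almost surely). Then, almost surely, for all $n\ge0$, $W_n^{0,S}\prec W_n^{0,S'}$, that is, $$W_n^{0,S}(S-i)\le W_n^{0,S'}(S'-i),\quad i\in\{0,1,\dots,S'-1\},$$ $$\sum_{i=1}^S W_n^{0,S}(i)\le\sum_{i=1}^{S'}W_n^{0,S'}(i).$$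
   Context: Notation: $x\wedge y=\min(x,y)$, $x\vee y=\max(x,y)$, $x^+=\max(x,0)$, $\mathbb R_+=[0,\infty)$. For $u\in(\mathbb R_+)^q$, $u(i)$ is its $i$-th coordinate, and by convention $u(q+1)=\infty$. Ordering: for positive integers $S'\le S$, $u\in(\mathbb R_+)^S$ and $v\in(\mathbb R_+)^{S'}$, write $u\prec v$ if $u(S-\ell)\le v(S'-\ell)$ for all integers $0\le\ell\le S'-1$ and $\sum_{i=1}^S u(i)\le\sum_{i=1}^{S'}v(i)$. Input: $(\sigma_n,\tau_n)_{n\in\mathbb N}$ is a stationary (hence identically distributed) sequence of random variables on a probability space, where $\sigma_n\ge0$ is the service time of customer $n$ and $\tau_n$ the inter-arrival time between customers $n$ and $n+1$; $\sigma_0$ and $\tau_0$ are integrable and $\tau_0>0$ a.s. Join the Shortest Workload (JSW) system with $S$ servers: each server has its own FIFO queue, and each incoming customer is definitively sent to the server of least workload. The workload profile $W_n^{0,S}\in(\mathbb R_+)^S$ is the vector of the workloads of the $S$ servers seen by customer $n$ upon arrival, in nondecreasing order (in particular $W_0^{0,S}(1)\le\dots\le W_0^{0,S}(S)$). It evolves by the driving map given for $u\in(\mathbb R_+)^S$, $s,t\ge0$ by $$\Phi^{0,S}(u,s,t)(i)=[u(i)\vee((u(1)+s)\wedge u(i+1))-t]^+,\quad 1\le i\le S,$$ which for $u$ nondecreasing is the nondecreasing rearrangement of $([u(1)+s-t]^+,[u(2)-t]^+,\dots,[u(S)-t]^+)$ (Kiefer–Wolfowitz recursion). The same definitions apply with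 $S'$ in place of $S$. *)

theory Defs
  imports "HOL-Probability.Probability"
begin

text \<open>
  A vector of \<open>\<real>\<^sup>q\<close> is a function \<^typ>\<open>nat \<Rightarrow> real\<close> with coordinates indexed by
  \<open>{1..q}\<close>; as a value of a random vector it is \<^const>\<open>undefined\<close> outside that set, i.e. it lies in
  the space of the product measure \<open>Pi\<^sub>M {1..q} (\<lambda>_. borel)\<close>.
\<close>

definition ordered_profile :: "nat \<Rightarrow> (nat \<Rightarrow> real) \<Rightarrow> bool" where
  "ordered_profile q u \<longleftrightarrow> (\<forall>i\<in>{1..q}. 0 \<le> u i) \<and> mono_on {1..q} u"

definition prec :: "nat \<Rightarrow> nat \<Rightarrow> (nat \<Rightarrow> real) \<Rightarrow> (nat \<Rightarrow> real) \<Rightarrow> bool" where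
  "prec S S' u v \<longleftrightarrow>
     (\<forall>l<S'. u (S - l) \<le> v (S' - l)) \<and> (\<Sum>i=1..S. u i) \<le> (\<Sum>i=1..S'. v i)"

text \<open>
  The Kiefer--Wolfowitz map. The branch \<open>i = q\<close> implements the convention \<open>u (q + 1) = \<infinity>\<close>
  (see \<open>jsw_map_ereal\<close>).
\<close>

definition jsw_map :: "nat \<Rightarrow> (nat \<Rightarrow> real) \<Rightarrow> real \<Rightarrow> real \<Rightarrow> nat \<Rightarrow> real" where
  "jsw_map q u s t =
     (\<lambda>i\<in>{1..q}.
        max (max (u i) (if i = q then u 1 + s else min (u 1 + s) (u (i + 1))) - t) 0)"

lemma jsw_map_ereal:
  fixes u :: "nat \<Rightarrow> real"
  assumes "i \<in> {1..q}"
  defines "c \<equiv> \<lambda>j. if j = q + 1 then \<infinity> else ereal (u j)"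
  shows "ereal (jsw_map q u s t i) = max (max (c i) (min (c 1 + ereal s) (c (i + 1))) - ereal t) 0"
  using assms by (auto simp: jsw_map_def max_def min_def zero_ereal_def)

lemma jsw_map_ordered_profile:
  assumes "ordered_profile q u"
  shows "ordered_profile q (jsw_map q u s t)"
proof -
  have m: "u i \<le> u j" if "1 \<le> i" "i \<le> j" "j \<le> q" for i j
    using assms that by (auto simp: ordered_profile_def mono_on_def)
  have "jsw_map q u s t i \<le> jsw_map q u s t j" if "1 \<le> i" "i < j" "j \<le> q" for i j
  proof -
    have "u i \<le> u (i + 1)" "u (i + 1) \<le> u j" using that by (auto intro!: m)
    then show ?thesis using that by (auto simp: jsw_map_def)
  qed
  then have "jsw_map q u s t i \<le> jsw_map q u s t j" if "1 \<le> i" "i \<le> j" "j \<le> q" for i j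
    using that by (cases "i = j") auto
  moreover have "0 \<le> jsw_map q u s t i" if "i \<in> {1..q}" for i
    using that by (simp add: jsw_map_def)
  ultimately show ?thesis by (auto simp: ordered_profile_def mono_on_def)
qed

definition stationary_sequence :: "'a measure \<Rightarrow> 'b measure \<Rightarrow> (nat \<Rightarrow> 'a \<Rightarrow> 'b) \<Rightarrow> bool" where
  "stationary_sequence M N X \<longleftrightarrow>
     (\<forall>n. X n \<in> measurable M N) \<and>
     (\<forall>k. distr M (Pi\<^sub>M UNIV (\<lambda>_. N)) (\<lambda>\<omega> n. X (n + k) \<omega>)
        = distr M (Pi\<^sub>M UNIV (\<lambda>_. N)) (\<lambda>\<omega> n. X n \<omega>))"

definition queue_input ::
  "'a measure \<Rightarrow> (nat \<Rightarrow> 'a \<Rightarrow> real) \<Rightarrow> (nat \<Rightarrow> 'a \<Rightarrow> real) \<Rightarrow> bool" where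
  "queue_input M \<sigma> \<tau> \<longleftrightarrow>
     stationary_sequence M (borel \<Otimes>\<^sub>M borel) (\<lambda>n \<omega>. (\<sigma> n \<omega>, \<tau> n \<omega>)) \<and>
     (\<forall>n. AE \<omega> in M. 0 \<le> \<sigma> n \<omega>) \<and> (AE \<omega> in M. 0 < \<tau> 0 \<omega>) \<and>
     integrable M (\<sigma> 0) \<and> integrable M (\<tau> 0)"

text \<open>
  Being ordered is only required of the initial profile, since \<^const>\<open>jsw_map\<close> preserves it
  (see \<open>jsw_map_ordered_profile\<close>).
\<close>

definition jsw_profiles ::
  "'a measure \<Rightarrow> nat \<Rightarrow> (nat \<Rightarrow> 'a \<Rightarrow> real) \<Rightarrow> (nat \<Rightarrow> 'a \<Rightarrow> real) \<Rightarrow> (nat \<Rightarrow> 'a \<Rightarrow> nat \<Rightarrow> real) \<Rightarrow> bool"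
  where
  "jsw_profiles M q \<sigma> \<tau> W \<longleftrightarrow>
     (\<forall>n. W n \<in> measurable M (Pi\<^sub>M {1..q} (\<lambda>_. borel))) \<and>
     (AE \<omega> in M. ordered_profile q (W 0 \<omega>)) \<and>
     (AE \<omega> in M. \<forall>n. W (Suc n) \<omega> = jsw_map q (W n \<omega>) (\<sigma> n \<omega>) (\<tau> n \<omega>))"

end

theory Submission
  imports Defs
begin

text \<open>
  Between two arrivals the profile undergoes two operations: the service time \<open>s\<close> is added to the
  smallest workload and the profile is sorted again, which is \<^term>\<open>jsw_map q u s 0\<close>; then every
  server drains, which replaces each coordinate \<open>x\<close> by \<open>max (x - t) 0\<close>. Both preserve \<^const>\<open>prec\<close>.

  Arrival: each new coordinate is a monotone expression of the same coordinate, the next larger one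
  and the smallest one. Counted from the top, coordinates are compared by hypothesis; and
  \<open>u 1 \<le> u (S - S' + 1) \<le> v 1\<close>, so that the smallest ones are compared as well. The total workload
  grows by exactly \<open>s\<close> in both systems (\<open>sum_jsw_map_0\<close>).

  Drain: only the total needs an argument (\<open>prec_drain\<close>). The \<open>S - S'\<close> smallest coordinates of
  \<open>u\<close> have no counterpart in \<open>v\<close>. Either all of them are emptied, and the comparison of the other
  coordinates suffices; or one of them exceeds \<open>t\<close>, and then at least \<open>S'\<close> servers work at full
  rate during the whole period, which takes off at least \<open>S' t\<close>, while a system of \<open>S'\<close> servers
  loses at most \<open>S' t\<close>.

  Hence the claim holds pathwise by induction on \<open>n\<close>. Probability enters only through the
  inter-arrival times, whose signs are known for the index \<open>0\<close> and carry over to all indices by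
  stationarity (\<open>AE_interarrival_nonneg\<close>).
\<close>

section \<open>Arrivals\<close>

text \<open>
  With \<open>c = u 1 + s\<close>, the new coordinate \<open>max (u i) (min c (u (i + 1)))\<close> of a nondecreasing profile
  equals \<open>u i + min c (u (i + 1)) - min c (u i)\<close>, so the differences telescope to
  \<open>c - min c (u 1) = s\<close>.
\<close>

lemma sum_jsw_map_0:
  assumes u: "ordered_profile q u" and "1 \<le> q" "0 \<le> s"
  shows "(\<Sum>i=1..q. jsw_map q u s 0 i) = (\<Sum>i=1..q. u i) + s"
proof -
  define c where "c = u 1 + s"
  \<comment> \<open>The value \<open>c\<close> at \<open>q + 1\<close> implements \<open>min c \<infinity> = c\<close>.\<close>
  define d where "d i = (if i = q + 1 then c else min c (u i))" for i
  have nonneg: "0 \<le> u i" if "i \<in> {1..q}" for i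
    using u that by (auto simp: ordered_profile_def)
  have "jsw_map q u s 0 i = u i + (d (Suc i) - d i)" if i: "i \<in> {1..q}" for i
  proof -
    have "u i \<le> u (i + 1)" if "i \<noteq> q"
      using u i that by (auto simp: ordered_profile_def mono_on_def)
    then show ?thesis
      using i nonneg[OF i] by (auto simp: jsw_map_def d_def c_def)
  qed
  then have "(\<Sum>i=1..q. jsw_map q u s 0 i) = (\<Sum>i=1..q. u i) + (\<Sum>i=1..q. d (Suc i) - d i)"
    by (simp add: sum.distrib)
  also have "(\<Sum>i=1..q. d (Suc i) - d i) = d (Suc q) - d 1"
    using \<open>1 \<le> q\<close> by (intro sum_Suc_diff) simp
  also have "\<dots> = s"
    using assms(2,3) by (simp add: d_def c_def)
  finally show ?thesis .
qed

lemma prec_jsw_map_0: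
  assumes "1 \<le> S'" "S' \<le> S" "0 \<le> s"
    and u: "ordered_profile S u" and v: "ordered_profile S' v" and uv: "prec S S' u v"
  shows "prec S S' (jsw_map S u s 0) (jsw_map S' v s 0)"
proof -
  have top: "u (S - l) \<le> v (S' - l)" if "l < S'" for l
    using uv that by (simp add: prec_def)
  have "u 1 \<le> u (S - (S' - 1))"
    using u assms(1,2) by (intro mono_onD[of "{1..S}" u]) (auto simp: ordered_profile_def)
  also have "\<dots> \<le> v 1"
    using top[of "S' - 1"] assms(1) by simp
  finally have least: "u 1 \<le> v 1" .
  have "jsw_map S u s 0 (S - l) \<le> jsw_map S' v s 0 (S' - l)" if l: "l < S'" for l
  proof (cases "l = 0")
    case True
    then show ?thesis using top[of 0] least assms(1,2) by (auto simp: jsw_map_def)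
  next
    case False
    have "u (S - l + 1) \<le> v (S' - l + 1)"
      using top[of "l - 1"] False l assms(2) by (simp add: Suc_diff_le)
    then show ?thesis
      using top[OF l] least False l assms(2) by (auto simp: jsw_map_def max_def min_def)
  qed
  moreover have "(\<Sum>i=1..S. jsw_map S u s 0 i) \<le> (\<Sum>i=1..S'. jsw_map S' v s 0 i)"
    using uv assms(1-3) by (subst (1 2) sum_jsw_map_0) (simp_all add: prec_def u v)
  ultimately show ?thesis unfolding prec_def by blast
qed

section \<open>Drain\<close>

lemma sum_top_le:
  fixes u v :: "nat \<Rightarrow> real"
  assumes "S' \<le> S" and "\<And>l. l < S' \<Longrightarrow> u (S - l) \<le> v (S' - l)"
  shows "(\<Sum>i=S - S' + 1..S. u i) \<le> (\<Sum>i=1..S'. v i)"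
proof -
  have "(\<Sum>i=S - S' + 1..S. u i) = (\<Sum>i=1..S'. u (i + (S - S')))"
    using assms(1) sum.shift_bounds_cl_nat_ivl[of u 1 "S - S'" S'] by (simp add: add.commute)
  also have "\<dots> \<le> (\<Sum>i=1..S'. v i)"
  proof (rule sum_mono)
    fix i assume "i \<in> {1..S'}"
    then show "u (i + (S - S')) \<le> v i"
      using assms(1) assms(2)[of "S' - i"] by (simp add: add.commute)
  qed
  finally show ?thesis .
qed

text \<open>
  If some unmatched coordinate exceeds \<open>t\<close>, then so do the \<open>S'\<close> largest ones, since \<open>u\<close> is
  nondecreasing; for these the truncation at \<open>0\<close> is void, and for the unmatched ones
  \<open>max (x - t) 0 \<le> x\<close> is enough.
\<close>

lemma prec_drain:
  fixes u v :: "nat \<Rightarrow> real"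
  assumes "S' \<le> S" "0 \<le> t" and u: "ordered_profile S u" and uv: "prec S S' u v"
  shows "prec S S' (\<lambda>i. max (u i - t) 0) (\<lambda>i. max (v i - t) 0)"
proof -
  have nonneg: "0 \<le> u i" if "i \<in> {1..S}" for i
    using u that by (auto simp: ordered_profile_def)
  have mono: "u i \<le> u j" if "1 \<le> i" "i \<le> j" "j \<le> S" for i j
    using u that by (auto simp: ordered_profile_def mono_on_def)
  have top: "max (u (S - l) - t) 0 \<le> max (v (S' - l) - t) 0" if "l < S'" for l
  proof -
    have "u (S - l) \<le> v (S' - l)" using uv that by (simp add: prec_def)
    then show ?thesis by auto
  qed
  have split: "(\<Sum>i=1..S. f i) = (\<Sum>i=1..S - S'. f i) + (\<Sum>i=S - S' + 1..S. f i)"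
    for f :: "nat \<Rightarrow> real"
    using assms(1) sum.ub_add_nat[of 1 "S - S'" f S'] by simp
  have "(\<Sum>i=1..S. max (u i - t) 0) \<le> (\<Sum>i=1..S'. max (v i - t) 0)"
  proof (cases "\<exists>i\<in>{1..S - S'}. t < u i")
    case False
    then have "(\<Sum>i=1..S - S'. max (u i - t) 0) = 0"
      by (intro sum.neutral) auto
    then show ?thesis
      unfolding split
      using sum_top_le[OF assms(1), of "\<lambda>i. max (u i - t) 0" "\<lambda>i. max (v i - t) 0"] top by simp
  next
    case True
    then obtain k where k: "k \<in> {1..S - S'}" "t < u k" by blast
    have busy: "max (u i - t) 0 = u i - t" if "i \<in> {S - S' + 1..S}" for i
      using mono[of k i] k that by auto
    have "(\<Sum>i=1..S. max (u i - t) 0) \<le> (\<Sum>i=1..S - S'. u i) + (\<Sum>i=S - S' + 1..S. u i - t)"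
      unfolding split
    proof (rule add_mono)
      show "(\<Sum>i=1..S - S'. max (u i - t) 0) \<le> (\<Sum>i=1..S - S'. u i)"
        using nonneg assms(2) by (intro sum_mono) auto
      show "(\<Sum>i=S - S' + 1..S. max (u i - t) 0) \<le> (\<Sum>i=S - S' + 1..S. u i - t)"
        by (rule sum_mono) (simp add: busy)
    qed
    also have "\<dots> = (\<Sum>i=1..S. u i) - real S' * t"
      using assms(1) by (simp only: split) (simp add: sum_subtractf)
    also have "\<dots> \<le> (\<Sum>i=1..S'. v i - t)"
      using uv by (simp add: prec_def sum_subtractf)
    also have "\<dots> \<le> (\<Sum>i=1..S'. max (v i - t) 0)"
      by (intro sum_mono) simp
    finally show ?thesis .
  qed
  then show ?thesis unfolding prec_def using top by blast
qed

section \<open>Comparison along a path\<close>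

lemma prec_cong:
  assumes "S' \<le> S" "\<And>i. i \<in> {1..S} \<Longrightarrow> u i = u' i" "\<And>i. i \<in> {1..S'} \<Longrightarrow> v i = v' i"
  shows "prec S S' u v \<longleftrightarrow> prec S S' u' v'"
  using assms by (simp add: prec_def)

lemma jsw_map_eq_drain:
  assumes "0 \<le> t" "i \<in> {1..q}"
  shows "jsw_map q u s t i = max (jsw_map q u s 0 i - t) 0"
proof -
  have "max (x - t) 0 = max (max x 0 - t) 0" for x :: real
    using assms(1) by auto
  then show ?thesis using assms(2) by (simp add: jsw_map_def)
qed

lemma prec_jsw_map:
  assumes "1 \<le> S'" "S' \<le> S" "0 \<le> s" "0 \<le> t"
    and "ordered_profile S u" "ordered_profile S' v" "prec S S' u v"
  shows "prec S S' (jsw_map S u s t) (jsw_map S' v s t)"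
proof -
  have "prec S S' (\<lambda>i. max (jsw_map S u s 0 i - t) 0) (\<lambda>i. max (jsw_map S' v s 0 i - t) 0)"
    using assms by (intro prec_drain prec_jsw_map_0 jsw_map_ordered_profile)
  then show ?thesis
    by (rule iffD2[OF prec_cong[OF assms(2)], rotated 2]) (rule jsw_map_eq_drain[OF assms(4)], assumption)+
qed

lemma prec_jsw_path:
  assumes "1 \<le> S'" "S' \<le> S" "\<And>n. 0 \<le> s n" "\<And>n. 0 \<le> t n"
    and "ordered_profile S (w 0)" "\<And>n. w (Suc n) = jsw_map S (w n) (s n) (t n)"
    and "ordered_profile S' (w' 0)" "\<And>n. w' (Suc n) = jsw_map S' (w' n) (s n) (t n)"
    and "prec S S' (w 0) (w' 0)"
  shows "prec S S' (w n) (w' n)"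
proof -
  have "ordered_profile S (w n) \<and> ordered_profile S' (w' n) \<and> prec S S' (w n) (w' n)"
    by (induction n) (use assms in \<open>auto intro: jsw_map_ordered_profile prec_jsw_map\<close>)
  then show ?thesis by simp
qed

section \<open>Random input\<close>

text \<open>
  Stationarity equates the laws of whole shifted sequences; evaluating them on an event that
  depends on the initial coordinate alone compares the single terms.
\<close>

lemma stationary_sequence_AE:
  assumes X: "stationary_sequence M N X" and P: "Measurable.pred N P"
    and AE_0: "AE \<omega> in M. P (X 0 \<omega>)"
  shows "AE \<omega> in M. P (X n \<omega>)"
proof -
  let ?PN = "Pi\<^sub>M UNIV (\<lambda>_::nat. N)"
  have [measurable]: "X k \<in> measurable M N" for k
    using X by (simp add: stationary_sequence_def)
  note P[measurable]
  have "(AE \<omega> in M. P (X k \<omega>)) \<longleftrightarrow> (AE x in distr M ?PN (\<lambda>\<omega> i. X (i + k) \<omega>). P (x 0))" for k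
    by (subst AE_distr_iff) (auto intro!: measurable_PiM_single' measurable_space[of "X _"])
  moreover have "distr M ?PN (\<lambda>\<omega> i. X (i + n) \<omega>) = distr M ?PN (\<lambda>\<omega> i. X (i + 0) \<omega>)"
    using X by (simp add: stationary_sequence_def)
  ultimately show ?thesis using AE_0 by metis
qed

lemma AE_interarrival_nonneg:
  assumes "queue_input M \<sigma> \<tau>"
  shows "AE \<omega> in M. 0 \<le> \<tau> n \<omega>"
proof -
  have X: "stationary_sequence M (borel \<Otimes>\<^sub>M borel) (\<lambda>n \<omega>. (\<sigma> n \<omega>, \<tau> n \<omega>))"
    and X_0: "AE \<omega> in M. 0 < snd (\<sigma> 0 \<omega>, \<tau> 0 \<omega>)"
    using assms by (simp_all add: queue_input_def)
  have "AE \<omega> in M. 0 < snd (\<sigma> n \<omega>, \<tau> n \<omega>)"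
    by (rule stationary_sequence_AE[where P = "\<lambda>x. 0 < snd x", OF X _ X_0]) simp
  then show ?thesis by eventually_elim simp
qed

theorem theorem2:
  fixes M :: "'a measure"
    and \<sigma> \<tau> :: "nat \<Rightarrow> 'a \<Rightarrow> real"
    and W W' :: "nat \<Rightarrow> 'a \<Rightarrow> nat \<Rightarrow> real"
    and S S' :: nat
  assumes "prob_space M"
    and "1 \<le> S'" and "S' \<le> S"
    and "queue_input M \<sigma> \<tau>"
    and "jsw_profiles M S \<sigma> \<tau> W"
    and "jsw_profiles M S' \<sigma> \<tau> W'"
    and "AE \<omega> in M. prec S S' (W 0 \<omega>) (W' 0 \<omega>)"
  shows "AE \<omega> in M. \<forall>n. prec S S' (W n \<omega>) (W' n \<omega>)"
proof -
  have "AE \<omega> in M. \<forall>n. 0 \<le> \<sigma> n \<omega>"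
    using assms(4) by (simp add: queue_input_def AE_all_countable)
  moreover have "AE \<omega> in M. \<forall>n. 0 \<le> \<tau> n \<omega>"
    using AE_interarrival_nonneg[OF assms(4)] by (simp add: AE_all_countable)
  moreover have "AE \<omega> in M. ordered_profile S (W 0 \<omega>)"
      "AE \<omega> in M. \<forall>n. W (Suc n) \<omega> = jsw_map S (W n \<omega>) (\<sigma> n \<omega>) (\<tau> n \<omega>)"
    using assms(5) by (simp_all add: jsw_profiles_def)
  moreover have "AE \<omega> in M. ordered_profile S' (W' 0 \<omega>)"
      "AE \<omega> in M. \<forall>n. W' (Suc n) \<omega> = jsw_map S' (W' n \<omega>) (\<sigma> n \<omega>) (\<tau> n \<omega>)"
    using assms(6) by (simp_all add: jsw_profiles_def)
  ultimately show ?thesis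
    using assms(7)
  proof eventually_elim
    case (elim \<omega>)
    then show ?case
      using prec_jsw_path[OF assms(2,3), of "\<lambda>n. \<sigma> n \<omega>" "\<lambda>n. \<tau> n \<omega>" "\<lambda>n. W n \<omega>" "\<lambda>n. W' n \<omega>"]
      by blast
  qed
qed

end
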